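(* Let $a\in\mathbb{R}$, $0<\nu<1$ and $M\ge 0$. Assume $F:\mathbb{N}_{a+1}\times[0,\infty)\to[0,\infty)$ satisfies a uniform Lipschitz condition with respect to its second variable, i.e., there is a constant $K>0$ such that $|F(t,u)-F(t,v)|\le K|u-v|$ for all $t\in\mathbb{N}_{a+1}$ and $u,v\in[0,\infty)$. Assume $p:\mathbb{N}_a\to(0,\infty)$ satisfies $\sum_{s=a}^{\infty}\frac{1}{p(s)}<\infty$, put $$w(t):=\exp\left(-\sum_{s=a}^{t}\frac{1}{p(s)}\right)\quad(t\in\mathbb{N}_{a-1}),\qquad L:=\lim_{t\to\infty}w(t)\in(0,1),$$ and let $(\zeta_M,d)$ be the complete metric space given by $$\zeta_M:=\{y:\mathbb{N}_{a-1}\to[M,\infty):\ \nabla y(t)\le 0\ \text{ for all } t\in\mathbb{N}_a,\ \text{ and } \nabla y(a)=0\},\qquad d(x,y):=\sup_{t\in\mathbb{N}_{a-1}}\frac{|x(t)-y(t)|}{w(t)}.$$ If (H1) the series $\displaystyle\sum_{s=a+1}^{\infty}\frac{1}{p(s)}\sum_{\tau=a+1}^{s}\frac{(s-\rho(\tau))^{\overline{\nu-1}}}{\Gamma(\nu)}F(\tau,y(\rho(\tau)))$ converges for every $y\in\zeta_M$, and (H2) $\displaystyle\alpha:=\frac{K}{L\,\Gamma(\nu+1)}\sum_{s=a+1}^{\infty}\frac{(s-a)^{\overline{\nu}}}{p(s)}<1$, then there exists a unique positive solution $y$ of the fractional difference equation $$\nabla_{a-1}^{\nu}(p\nabla y)(t)+F(t,y(\rho(t)))=0,\qquad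 t\in\mathbb{N}_{a+1},$$ with $\displaystyle\lim_{t\to\infty}y(t)=M$.
   Context: For a real number $c$, $\mathbb{N}_c:=\{c,c+1,c+2,\dots\}$. The backward jump is $\rho(t):=t-1$, and the nabla difference is $\nabla y(t):=y(t)-y(t-1)$; $(p\nabla y)(t):=p(t)\nabla y(t)$. The generalized rising function is $t^{\overline{r}}:=\Gamma(t+r)/\Gamma(t)$ for $t,t+r\notin\{0,-1,-2,\dots\}$, with the convention $t^{\overline{r}}:=0$ if $t$ is a nonpositive integer but $t+r$ is not. Empty sums are $0$ (so $w(a-1)=1$). For $c\in\mathbb{R}$, $\mu>0$ and $g:\mathbb{N}_{c+1}\to\mathbb{R}$, the nabla fractional sum of order $\mu$ based at $c$ is $$\nabla_c^{-\mu}g(t):=\frac{1}{\Gamma(\mu)}\sum_{s=c+1}^{t}(t-\rho(s))^{\overline{\mu-1}}g(s),\qquad t\in\mathbb{N}_c.$$ For $0<\nu<1$, the nabla fractional difference of order $\nu$ based at $c$ is $\nabla_c^{\nu}g(t):=\nabla\big(\nabla_c^{-(1-\nu)}g\big)(t)$, $t\in\mathbb{N}_{c+1}$.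
   Formalization: Existence and uniqueness are meant within ζ_M (so ∇y(a)=0), as uniqueness fails otherwise; strict positivity is claimed only if M>0 or F(t,0)≠0 for some t, since for M=0 and F(·,0)=0 the unique solution in ζ_0 is zero. *)

theory Defs
  imports "HOL-Analysis.Analysis"
begin

definition nabla_dom :: "real \<Rightarrow> real set" where
  "nabla_dom c = range (\<lambda>n::nat. c + real n)"

definition backward_jump :: "real \<Rightarrow> real" where
  "backward_jump t = t - 1"

definition nabla :: "(real \<Rightarrow> real) \<Rightarrow> real \<Rightarrow> real" where
  "nabla y t = y t - y (backward_jump t)"

text \<open>
  Since the library's Gamma function is 0 at its poles and division by 0 yields 0, this is 0
  whenever t is a nonpositive integer, in accordance with the usual convention.
\<close>

definition rising :: "real \<Rightarrow> real \<Rightarrow> real" where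
  "rising t r = Gamma (t + r) / Gamma t"

text \<open>
  The sum from c to t in unit steps; only meant for t in \<open>nabla_dom (c - 1)\<close>,
  and empty for t = c - 1.
\<close>

definition nabla_sum :: "real \<Rightarrow> real \<Rightarrow> (real \<Rightarrow> real) \<Rightarrow> real" where
  "nabla_sum c t f = (\<Sum>s\<in>{s \<in> nabla_dom c. s \<le> t}. f s)"

definition frac_sum :: "real \<Rightarrow> real \<Rightarrow> (real \<Rightarrow> real) \<Rightarrow> real \<Rightarrow> real" where
  "frac_sum c \<mu> g t =
     1 / Gamma \<mu> * nabla_sum (c + 1) t (\<lambda>s. rising (t - backward_jump s) (\<mu> - 1) * g s)"

text \<open>Only meant for orders strictly between 0 and 1.\<close>

definition frac_diff :: "real \<Rightarrow> real \<Rightarrow> (real \<Rightarrow> real) \<Rightarrow> real \<Rightarrow> real" where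
  "frac_diff c \<nu> g t = nabla (frac_sum c (1 - \<nu>) g) t"

definition weight :: "real \<Rightarrow> (real \<Rightarrow> real) \<Rightarrow> real \<Rightarrow> real" where
  "weight a p t = exp (- nabla_sum a t (\<lambda>s. 1 / p s))"

text \<open>
  Functions on the discrete half-line are total functions that are \<open>undefined\<close> outside of it, so
  that equality of elements of \<open>zeta a M\<close> is equality on \<open>nabla_dom (a - 1)\<close>.
\<close>

definition zeta :: "real \<Rightarrow> real \<Rightarrow> (real \<Rightarrow> real) set" where
  "zeta a M = {y \<in> nabla_dom (a - 1) \<rightarrow>\<^sub>E {M..}.
                 (\<forall>t\<in>nabla_dom a. nabla y t \<le> 0) \<and> nabla y a = 0}"

text \<open>The metric that turns \<open>zeta a M\<close> into a complete metric space.\<close>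

definition zeta_dist :: "real \<Rightarrow> (real \<Rightarrow> real) \<Rightarrow> (real \<Rightarrow> real) \<Rightarrow> (real \<Rightarrow> real) \<Rightarrow> real" where
  "zeta_dist a p x y = (SUP t\<in>nabla_dom (a - 1). \<bar>x t - y t\<bar> / weight a p t)"

definition is_solution ::
  "real \<Rightarrow> real \<Rightarrow> (real \<Rightarrow> real) \<Rightarrow> (real \<Rightarrow> real \<Rightarrow> real) \<Rightarrow> (real \<Rightarrow> real) \<Rightarrow> bool" where
  "is_solution a \<nu> p F y \<longleftrightarrow>
     (\<forall>t\<in>nabla_dom (a + 1).
        frac_diff (a - 1) \<nu> (\<lambda>s. p s * nabla y s) t + F t (y (backward_jump t)) = 0)"

end

theory Submission
  imports Defs
begin

text \<open>
  Let $b$, $c$ be the coefficient sequences of $(1-X)^{\nu-1}$ and $(1-X)^{-\nu}$. The fractional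
  difference of $p\nabla y$ is its product with $(1-X)\,b$ as a formal power series, and
  $(1-X)\,b\,c = 1$. As $\nabla y(a) = 0$, the equation therefore says
  $p\nabla y(s) = -\sum_{\tau=a+1}^{s} c_{s-\tau} F(\tau, y(\rho(\tau)))$; together with
  $y \to M$ this makes $y$ a fixed point of the tail-sum operator
  $y \mapsto M + \sum_{s>t} p(s)^{-1} \sum_{\tau} c_{s-\tau} F(\tau, y(\rho(\tau)))$. Since
  $L \le w \le 1$, the weight can be dropped: the operator is already a contraction for the
  unweighted supremum distance, with constant $\alpha L \le \alpha < 1$.
\<close>

section \<open>Tail sums and a Banach fixed-point argument for decreasing sequences\<close>

text \<open>Telescoping gives one direction; for the other, the tails of a summable series tend to
  0. This trades a first-order recursion with a boundary condition at infinity for a fixed-point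
  equation.\<close>

lemma tail_sum_recursion:
  fixes Z u :: "nat \<Rightarrow> real"
  assumes "summable u"
  shows "(\<forall>n. Z n - Z (Suc n) = u n) \<and> Z \<longlonglongrightarrow> M \<longleftrightarrow> (\<forall>n. Z n = M + (\<Sum>j. u (j + n)))"
proof
  assume Z: "(\<forall>n. Z n - Z (Suc n) = u n) \<and> Z \<longlonglongrightarrow> M"
  show "\<forall>n. Z n = M + (\<Sum>j. u (j + n))"
  proof
    fix n
    have "(\<lambda>j. Z (j + n)) \<longlonglongrightarrow> M"
      using Z LIMSEQ_ignore_initial_segment by blast
    from telescope_sums'[OF this] have "(\<lambda>j. u (j + n)) sums (Z n - M)"
      using Z by simp
    then show "Z n = M + (\<Sum>j. u (j + n))"
      by (simp add: sums_iff)
  qed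
next
  assume Z: "\<forall>n. Z n = M + (\<Sum>j. u (j + n))"
  have "Z n - Z (Suc n) = u n" for n
    using Z suminf_split_head[OF summable_ignore_initial_segment[OF assms, of n]] by simp
  moreover have "Z = (\<lambda>n. M + (\<Sum>j. u (j + n)))"
    using Z by auto
  moreover have "(\<lambda>n. M + (\<Sum>j. u (j + n))) \<longlonglongrightarrow> M + 0"
    by (intro tendsto_add tendsto_const suminf_exist_split2 assms)
  ultimately show "(\<forall>n. Z n - Z (Suc n) = u n) \<and> Z \<longlonglongrightarrow> M"
    by auto
qed

text \<open>The library's completeness instance needs a metric on the domain, which \<open>nat\<close> lacks.\<close>

lemma complete_UNIV_bcontfun:
  "complete (UNIV :: ('a::topological_space \<Rightarrow>\<^sub>C 'b::complete_space) set)"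
proof (rule completeI)
  fix f :: "nat \<Rightarrow> 'a \<Rightarrow>\<^sub>C 'b"
  assume "Cauchy f"
  then have "uniformly_Cauchy_on UNIV (\<lambda>n. apply_bcontfun (f n))"
    unfolding Cauchy_def uniformly_Cauchy_on_def
    by (metis dist_bounded le_less_trans)
  then obtain g where "uniform_limit UNIV (\<lambda>n. apply_bcontfun (f n)) g sequentially"
    by (metis Cauchy_uniformly_convergent uniformly_convergent_on_def)
  then obtain l where "f \<longlonglongrightarrow> l"
    by (rule uniform_limit_bcontfunE) simp_all
  then show "\<exists>l\<in>UNIV. f \<longlonglongrightarrow> l"
    by blast
qed

text \<open>Banach's theorem for the tail-sum operator \<open>T\<close>. Nonnegative increments keep
  \<open>T Z\<close> decreasing and above \<open>M\<close>. By the Lipschitz condition, a change of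
  size d in \<open>Z\<close> alters \<open>u Z n\<close> by at most
  \<open>Q n * e n * (K * d)\<close>, where \<open>e n\<close> is the total mass of the kernel;
  summing over \<open>n\<close> gives the contraction constant.\<close>

lemma ex1_decreasing_volterra_solution:
  fixes Q c e :: "nat \<Rightarrow> real" and f :: "nat \<Rightarrow> real \<Rightarrow> real" and u :: "(nat \<Rightarrow> real) \<Rightarrow> nat \<Rightarrow> real"
  defines "u \<equiv> \<lambda>Z n. Q n * (\<Sum>k\<le>n. c (n - k) * f k (Z k))"
  assumes M: "0 \<le> M" and Q: "\<And>n. 0 \<le> Q n" and c: "\<And>n. 0 \<le> c n"
    and f: "\<And>k v. 0 \<le> v \<Longrightarrow> 0 \<le> f k v" and K: "0 \<le> K"
    and Lip: "\<And>k v w. 0 \<le> v \<Longrightarrow> 0 \<le> w \<Longrightarrow> \<bar>f k v - f k w\<bar> \<le> K * \<bar>v - w\<bar>"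
    and e: "\<And>n. e n = (\<Sum>k\<le>n. c (n - k))"
    and sum_u: "\<And>Z. antimono Z \<Longrightarrow> (\<And>n. M \<le> Z n) \<Longrightarrow> summable (u Z)"
    and sum_Qe: "summable (\<lambda>n. Q n * e n)"
    and contr: "K * (\<Sum>n. Q n * e n) < 1"
  shows "\<exists>!Z. antimono Z \<and> (\<forall>n. M \<le> Z n) \<and> (\<forall>n. Z n - Z (Suc n) = u Z n) \<and> Z \<longlonglongrightarrow> M"
proof -
  define D where "D = {Z::nat \<Rightarrow> real. antimono Z \<and> (\<forall>n. M \<le> Z n)}"
  define T where "T = (\<lambda>Z n. M + (\<Sum>j. u Z (j + n)))"
  \<comment> \<open>Every function on the discrete space \<open>nat\<close> is continuous and
    members of \<open>D\<close> lie between \<open>M\<close> and their first value, so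
    \<open>D\<close> embeds into the bounded continuous functions with their complete supremum
    metric.\<close>
  define S where "S = {g :: nat \<Rightarrow>\<^sub>C real. apply_bcontfun g \<in> D}"
  have sumD: "summable (\<lambda>j. u Z (j + n))" if "Z \<in> D" for Z n
    using that sum_u by (intro summable_ignore_initial_segment) (auto simp: D_def)
  have posD: "0 \<le> Z n" if "Z \<in> D" for Z n
    using that M order_trans unfolding D_def by blast
  have u_nonneg: "0 \<le> u Z n" if "Z \<in> D" for Z n
    unfolding u_def using that by (intro mult_nonneg_nonneg Q sum_nonneg c f posD)
  have T_step: "T Z n - T Z (Suc n) = u Z n" if "Z \<in> D" for Z n
    using tail_sum_recursion[of "u Z" "T Z" M] sumD[OF that, of 0] by (auto simp: T_def)
  have T_D: "T Z \<in> D" if "Z \<in> D" for Z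
  proof -
    have "antimono (T Z)"
      using T_step[OF that] u_nonneg[OF that] by (intro decseq_SucI) (metis diff_ge_0_iff_ge)
    moreover have "M \<le> T Z n" for n
      using suminf_nonneg[OF sumD[OF that, of n]] u_nonneg[OF that] by (simp add: T_def)
    ultimately show ?thesis
      by (simp add: D_def)
  qed
  have D_bcontfun: "Z \<in> bcontfun" if "Z \<in> D" for Z
  proof -
    have "Z n \<in> {M..Z 0}" for n
      using that by (auto simp: D_def antimono_def)
    then have "bounded (range Z)"
      by (intro bounded_subset[OF bounded_closed_interval[of M "Z 0"]]) auto
    then show ?thesis
      by (auto simp: bcontfun_def)
  qed
  have T_lip: "\<bar>T (apply_bcontfun g) n - T (apply_bcontfun h) n\<bar> \<le> K * (\<Sum>n. Q n * e n) * dist g h"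
    if g: "g \<in> S" and h: "h \<in> S" for g h n
  proof -
    let ?g = "apply_bcontfun g" and ?h = "apply_bcontfun h"
    have D: "?g \<in> D" "?h \<in> D"
      using g h by (auto simp: S_def)
    have e_nonneg: "0 \<le> Q m * e m" for m
      unfolding e by (intro mult_nonneg_nonneg Q sum_nonneg c)
    have bound: "\<bar>u ?g m - u ?h m\<bar> \<le> Q m * e m * (K * dist g h)" for m
    proof -
      have "\<bar>(\<Sum>k\<le>m. c (m - k) * f k (?g k)) - (\<Sum>k\<le>m. c (m - k) * f k (?h k))\<bar>
          \<le> (\<Sum>k\<le>m. \<bar>c (m - k) * (f k (?g k) - f k (?h k))\<bar>)"
        unfolding sum_subtractf[symmetric] right_diff_distrib[symmetric] by (rule sum_abs)
      also have "\<dots> \<le> (\<Sum>k\<le>m. c (m - k) * (K * dist g h))"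
      proof (rule sum_mono)
        fix k
        have "\<bar>f k (?g k) - f k (?h k)\<bar> \<le> K * \<bar>?g k - ?h k\<bar>"
          by (intro Lip posD D)
        also have "\<dots> \<le> K * dist g h"
          using dist_bounded[of g k h] K by (intro mult_left_mono) (auto simp: dist_real_def)
        finally show "\<bar>c (m - k) * (f k (?g k) - f k (?h k))\<bar> \<le> c (m - k) * (K * dist g h)"
          using c[of "m - k"] by (simp add: abs_mult mult_left_mono)
      qed
      also have "\<dots> = e m * (K * dist g h)"
        by (simp add: e sum_distrib_right)
      finally show ?thesis
        using Q[of m] unfolding u_def right_diff_distrib[symmetric] abs_mult
        by (simp add: mult_left_mono mult.assoc)
    qed
    have sum_b: "summable (\<lambda>j. Q (j + n) * e (j + n) * (K * dist g h))"
      by (intro summable_mult2 summable_ignore_initial_segment[OF sum_Qe])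
    have sum_a: "summable (\<lambda>j. \<bar>u ?g (j + n) - u ?h (j + n)\<bar>)"
      by (rule summable_comparison_test'[OF sum_b, of 0]) (use bound in auto)
    have "\<bar>T ?g n - T ?h n\<bar> = \<bar>\<Sum>j. u ?g (j + n) - u ?h (j + n)\<bar>"
      using suminf_diff[OF sumD[OF D(1)] sumD[OF D(2)], of n n] by (simp add: T_def)
    also have "\<dots> \<le> (\<Sum>j. \<bar>u ?g (j + n) - u ?h (j + n)\<bar>)"
      by (rule summable_rabs[OF sum_a])
    also have "\<dots> \<le> (\<Sum>j. Q (j + n) * e (j + n) * (K * dist g h))"
      by (rule suminf_le[OF bound sum_a sum_b])
    also have "\<dots> = (\<Sum>j. Q (j + n) * e (j + n)) * (K * dist g h)"
      by (rule suminf_mult2[symmetric]) (rule summable_ignore_initial_segment[OF sum_Qe])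
    \<comment> \<open>The first \<open>n\<close> terms left out of the tail are nonnegative, so the
      full series gives a bound independent of \<open>n\<close>.\<close>
    also have "\<dots> \<le> (\<Sum>n. Q n * e n) * (K * dist g h)"
      using suminf_split_initial_segment[OF sum_Qe, of n] e_nonneg K
      by (intro mult_right_mono) (auto simp: sum_nonneg)
    finally show ?thesis
      by (simp add: mult_ac)
  qed
  have "closed S"
  proof -
    \<comment> \<open>Evaluation at a point is 1-Lipschitz, so the pointwise inequalities that cut
      out \<open>S\<close> are closed conditions.\<close>
    have cont: "continuous_on UNIV (\<lambda>g :: nat \<Rightarrow>\<^sub>C real. apply_bcontfun g n)" for n
      by (rule continuous_onI) (metis dist_bounded order_trans less_imp_le)
    have "S = {g. \<forall>m n. m \<le> n \<longrightarrow> apply_bcontfun g n \<le> apply_bcontfun g m} \<inter> {g. \<forall>n. M \<le> apply_bcontfun g n}"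
      by (auto simp: S_def D_def antimono_def)
    then show ?thesis
      by (simp only:) (intro closed_Int closed_Collect_all closed_Collect_imp open_Collect_const
        closed_Collect_le cont continuous_on_const)
  qed
  then have "complete S"
    using complete_closed_subset[OF _ subset_UNIV complete_UNIV_bcontfun] by blast
  \<comment> \<open>Banach's theorem requires a nonempty set; the constant \<open>M\<close> is a
    member.\<close>
  moreover have "Bcontfun (\<lambda>_. M) \<in> S"
    using D_bcontfun[of "\<lambda>_. M"] by (simp add: S_def D_def Bcontfun_inverse antimono_def)
  moreover have "0 \<le> K * (\<Sum>n. Q n * e n)"
    using K Q c by (intro mult_nonneg_nonneg suminf_nonneg[OF sum_Qe]) (auto simp: e sum_nonneg)
  moreover have app: "apply_bcontfun (Bcontfun (T (apply_bcontfun g))) = T (apply_bcontfun g)" if "g \<in> S" for g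
    using that by (intro Bcontfun_inverse D_bcontfun T_D) (simp add: S_def)
  then have "(\<lambda>g. Bcontfun (T (apply_bcontfun g))) ` S \<subseteq> S"
    by (auto simp: S_def intro: T_D)
  moreover have "dist (Bcontfun (T (apply_bcontfun g))) (Bcontfun (T (apply_bcontfun h)))
      \<le> K * (\<Sum>n. Q n * e n) * dist g h" if "g \<in> S \<and> h \<in> S" for g h
    using that by (intro dist_bound) (simp add: app dist_real_def T_lip)
  ultimately have "\<exists>!g. g \<in> S \<and> Bcontfun (T (apply_bcontfun g)) = g"
    using contr by (intro Banach_fix[where c = "K * (\<Sum>n. Q n * e n)"]) blast+
  then obtain g where g: "g \<in> S" "Bcontfun (T (apply_bcontfun g)) = g"
    and uniq: "\<And>h. h \<in> S \<Longrightarrow> Bcontfun (T (apply_bcontfun h)) = h \<Longrightarrow> h = g"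
    by blast
  have fix_iff: "(\<forall>n. Z n - Z (Suc n) = u Z n) \<and> Z \<longlonglongrightarrow> M \<longleftrightarrow> T Z = Z" if "Z \<in> D" for Z
    using tail_sum_recursion[of "u Z" Z M] sumD[OF that, of 0] by (auto simp: T_def fun_eq_iff)
  have "\<exists>!Z. Z \<in> D \<and> T Z = Z"
  proof (rule ex1I)
    show "apply_bcontfun g \<in> D \<and> T (apply_bcontfun g) = apply_bcontfun g"
      using g app by (metis S_def mem_Collect_eq)
  next
    fix Z assume Z: "Z \<in> D \<and> T Z = Z"
    then have inv: "apply_bcontfun (Bcontfun Z) = Z"
      by (intro Bcontfun_inverse D_bcontfun) simp
    then have "Bcontfun Z = g"
      using Z by (intro uniq) (auto simp: S_def)
    with inv show "Z = apply_bcontfun g"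
      by simp
  qed
  moreover have "antimono Z \<and> (\<forall>n. M \<le> Z n) \<and> (\<forall>n. Z n - Z (Suc n) = u Z n) \<and> Z \<longlonglongrightarrow> M
      \<longleftrightarrow> Z \<in> D \<and> T Z = Z" for Z
    using fix_iff[of Z] by (auto simp: D_def)
  ultimately show ?thesis
    by simp
qed

section \<open>Binomial-series coefficients and inversion of the fractional difference\<close>

text \<open>The coefficient of X^n in (1 - X)^(-x).\<close>

definition rising_coeff :: "real \<Rightarrow> nat \<Rightarrow> real" where
  "rising_coeff x n = pochhammer x n / fact n"

lemma rising_coeff_pos: "0 < x \<Longrightarrow> 0 < rising_coeff x n"
  by (simp add: rising_coeff_def pochhammer_pos)

text \<open>Identifies the normalised fractional kernel, using \<open>Gamma (n + 1) = fact n\<close>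
  and \<open>pochhammer x n = Gamma (x + n) / Gamma x\<close>; the latter needs \<open>x\<close> not
  to be a pole.\<close>

lemma rising_eq_coeff:
  assumes "0 < x"
  shows "rising (real n + 1) (x - 1) / Gamma x = rising_coeff x n"
proof -
  have "x \<notin> \<int>\<^sub>\<le>\<^sub>0"
    using assms by (auto elim!: nonpos_Ints_cases)
  then show ?thesis
    using Gamma_fact[of n, where ?'a = real]
    by (simp add: rising_def rising_coeff_def pochhammer_Gamma add_ac)
qed

text \<open>The Vandermonde identity for rising factorials: exponents add when powers of 1 - X are
  multiplied.\<close>

lemma sum_rising_coeff_mult:
  "(\<Sum>k\<le>n. rising_coeff x k * rising_coeff y (n - k)) = rising_coeff (x + y) n"
proof -
  have "rising_coeff x k * rising_coeff y (n - k)
      = real (n choose k) * pochhammer x k * pochhammer y (n - k) / fact n" if "k \<le> n" for k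
    using that by (simp add: rising_coeff_def binomial_fact)
  then show ?thesis
    by (simp add: rising_coeff_def[of "x + y"] pochhammer_binomial_sum sum_divide_distrib)
qed

lemma rising_coeff_1: "rising_coeff 1 n = 1"
  by (simp add: rising_coeff_def pochhammer_fact[symmetric])

text \<open>Multiplication by 1/(1 - X) forms partial sums of coefficients. This raises the order of
  the kernel from \<nu> to \<nu> + 1, the order that occurs in \<open>H2\<close>.\<close>

lemma sum_rising_coeff: "(\<Sum>k\<le>n. rising_coeff x (n - k)) = rising_coeff (x + 1) n"
  using sum_rising_coeff_mult[where x = 1 and y = x] by (simp add: rising_coeff_1 add.commute)

text \<open>In power series the equation reads
  \<open>(1 - fps_X) * (B * \<Gamma>) = - (fps_X * \<Phi>)\<close>, the factor \<open>fps_X\<close>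
  reflecting that it starts at index 1. Multiplying by \<open>C\<close>, or back by
  \<open>(1 - fps_X) * B\<close>, passes between the two sides.\<close>

lemma fractional_equation_solve:
  fixes G \<phi> :: "nat \<Rightarrow> real"
  assumes G0: "G 0 = 0"
  shows "(\<forall>n. (\<Sum>k\<le>Suc n. rising_coeff (1 - \<nu>) (Suc n - k) * G k)
              - (\<Sum>k\<le>n. rising_coeff (1 - \<nu>) (n - k) * G k) = - \<phi> n)
     \<longleftrightarrow> (\<forall>n. G (Suc n) = - (\<Sum>k\<le>n. rising_coeff \<nu> (n - k) * \<phi> k))"
    (is "?lhs \<longleftrightarrow> ?rhs")
proof -
  define B where "B = Abs_fps (rising_coeff (1 - \<nu>))"
  define C where "C = Abs_fps (rising_coeff \<nu>)"
  define \<Gamma> where "\<Gamma> = Abs_fps G"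
  define \<Phi> where "\<Phi> = Abs_fps \<phi>"
  have conv: "(\<Sum>k\<le>n. b (n - k) * g k) = fps_nth (Abs_fps b * Abs_fps g) n"
    for b g :: "nat \<Rightarrow> real" and n
    unfolding mult.commute[of "Abs_fps b" "Abs_fps g"] fps_mult_nth atLeast0AtMost
    by (simp add: mult.commute)
  \<comment> \<open>The exponents \<nu> - 1 and -\<nu> add up to -1, which is the geometric
    series.\<close>
  have "B * C = Abs_fps (\<lambda>_. 1)"
    using sum_rising_coeff_mult[where x = "1 - \<nu>" and y = \<nu>]
    by (intro fps_ext) (simp add: B_def C_def fps_mult_nth atLeast0AtMost rising_coeff_1)
  then have inv: "(1 - fps_X) * (B * C) = 1"
    by (intro fps_ext) (simp add: left_diff_distrib)
  have "?lhs \<longleftrightarrow> (1 - fps_X) * (B * \<Gamma>) = - (fps_X * \<Phi>)"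
  proof -
    \<comment> \<open>\<open>?lhs\<close> says nothing about the constant coefficients; both vanish,
      the left one by \<open>G0\<close>.\<close>
    have "fps_nth ((1 - fps_X) * (B * \<Gamma>)) 0 = fps_nth (- (fps_X * \<Phi>)) 0"
      by (simp add: \<Gamma>_def G0)
    moreover have "fps_nth ((1 - fps_X) * (B * \<Gamma>)) (Suc n)
        = fps_nth (B * \<Gamma>) (Suc n) - fps_nth (B * \<Gamma>) n"
      "fps_nth (- (fps_X * \<Phi>)) (Suc n) = - \<phi> n" for n
      by (simp_all add: left_diff_distrib \<Phi>_def)
    ultimately show ?thesis
      unfolding fps_eq_iff conv B_def[symmetric] \<Gamma>_def[symmetric]
      by (metis not0_implies_Suc)
  qed
  also have "\<dots> \<longleftrightarrow> \<Gamma> = - (fps_X * (C * \<Phi>))"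
  proof
    assume "(1 - fps_X) * (B * \<Gamma>) = - (fps_X * \<Phi>)"
    then have "(1 - fps_X) * (B * C) * \<Gamma> = - (fps_X * (C * \<Phi>))"
      by (metis (no_types, opaque_lifting) mult.left_commute mult.assoc mult_minus_right mult.commute)
    then show "\<Gamma> = - (fps_X * (C * \<Phi>))"
      by (simp only: inv mult_1)
  next
    assume "\<Gamma> = - (fps_X * (C * \<Phi>))"
    then have "(1 - fps_X) * (B * \<Gamma>) = - ((1 - fps_X) * (B * C) * (fps_X * \<Phi>))"
      by (simp only: mult_minus_right mult_ac)
    then show "(1 - fps_X) * (B * \<Gamma>) = - (fps_X * \<Phi>)"
      by (simp only: inv mult_1)
  qed
  also have "\<dots> \<longleftrightarrow> ?rhs"
  proof -
    have "fps_nth \<Gamma> 0 = fps_nth (- (fps_X * (C * \<Phi>))) 0"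
      by (simp add: \<Gamma>_def G0)
    moreover have "fps_nth \<Gamma> (Suc n) = G (Suc n)"
      "fps_nth (- (fps_X * (C * \<Phi>))) (Suc n) = - fps_nth (C * \<Phi>) n" for n
      by (simp_all add: \<Gamma>_def)
    ultimately show ?thesis
      unfolding fps_eq_iff conv C_def[symmetric] \<Phi>_def[symmetric]
      by (metis not0_implies_Suc)
  qed
  finally show ?thesis .
qed

section \<open>Translation from the discrete half-line to sequences\<close>

lemma nabla_sum_conv: "nabla_sum c (c + real n) f = (\<Sum>k\<le>n. f (c + real k))"
proof -
  have "{s \<in> nabla_dom c. s \<le> c + real n} = (\<lambda>k. c + real k) ` {..n}"
    by (auto simp: nabla_dom_def)
  then show ?thesis
    by (simp add: nabla_sum_def sum.reindex inj_on_def)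
qed

lemma nabla_dom_ball: "(\<forall>t\<in>nabla_dom c. P t) \<longleftrightarrow> (\<forall>n. P (c + real n))"
  by (auto simp: nabla_dom_def)

text \<open>The sum based at \<open>a - 1\<close> starts at s = a. For t = a + n and s = a + k the
  kernel argument t - \<rho>(s) is n - k + 1, which is the shape handled by
  \<open>rising_eq_coeff\<close>.\<close>

lemma frac_sum_conv:
  assumes "\<nu> < 1"
  shows "frac_sum (a - 1) (1 - \<nu>) g (a + real n) = (\<Sum>k\<le>n. rising_coeff (1 - \<nu>) (n - k) * g (a + real k))"
proof -
  have "rising (a + real n - backward_jump (a + real k)) (- \<nu>) / Gamma (1 - \<nu>) = rising_coeff (1 - \<nu>) (n - k)"
    if "k \<le> n" for k
    using rising_eq_coeff[of "1 - \<nu>" "n - k"] assms that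
    by (simp add: backward_jump_def of_nat_diff algebra_simps)
  then show ?thesis
    by (auto simp: frac_sum_def nabla_sum_conv sum_distrib_left intro!: sum.cong)
      (metis times_divide_eq_left)
qed

text \<open>Here p \<nabla>y plays the role of \<open>G\<close>, and \<open>y0\<close> supplies
  \<open>G 0 = 0\<close>. After inversion, dividing by the nonzero value of \<open>p\<close> leaves
  the explicit decrement of \<open>y\<close>.\<close>

lemma is_solution_iff:
  assumes nu: "\<nu> < 1" and y0: "nabla y a = 0" and p: "\<And>n. p (a + real n) \<noteq> 0"
  shows "is_solution a \<nu> p F y \<longleftrightarrow>
    (\<forall>n. y (a + real n) - y (a + real (Suc n))
      = 1 / p (a + 1 + real n) * (\<Sum>k\<le>n. rising_coeff \<nu> (n - k) * F (a + 1 + real k) (y (a + real k))))"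
proof -
  define G where "G = (\<lambda>n. p (a + real n) * nabla y (a + real n))"
  define \<phi> where "\<phi> = (\<lambda>k. F (a + 1 + real k) (y (a + real k)))"
  have diff: "frac_diff (a - 1) \<nu> (\<lambda>s. p s * nabla y s) (a + 1 + real n)
      = (\<Sum>k\<le>Suc n. rising_coeff (1 - \<nu>) (Suc n - k) * G k)
        - (\<Sum>k\<le>n. rising_coeff (1 - \<nu>) (n - k) * G k)" for n
    using frac_sum_conv[OF nu, of a "\<lambda>s. p s * nabla y s" n]
      frac_sum_conv[OF nu, of a "\<lambda>s. p s * nabla y s" "Suc n"]
    by (simp add: frac_diff_def nabla_def[of "frac_sum _ _ _"] backward_jump_def G_def add_ac)
  have "is_solution a \<nu> p F y \<longleftrightarrow>
      (\<forall>n. (\<Sum>k\<le>Suc n. rising_coeff (1 - \<nu>) (Suc n - k) * G k)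
        - (\<Sum>k\<le>n. rising_coeff (1 - \<nu>) (n - k) * G k) = - \<phi> n)"
    unfolding is_solution_def nabla_dom_ball diff \<phi>_def eq_neg_iff_add_eq_0
    by (simp add: backward_jump_def)
  also have "\<dots> \<longleftrightarrow> (\<forall>n. G (Suc n) = - (\<Sum>k\<le>n. rising_coeff \<nu> (n - k) * \<phi> k))"
    by (rule fractional_equation_solve) (simp add: G_def y0)
  also have "\<dots> \<longleftrightarrow> (\<forall>n. y (a + real n) - y (a + real (Suc n))
      = 1 / p (a + 1 + real n) * (\<Sum>k\<le>n. rising_coeff \<nu> (n - k) * \<phi> k))"
  proof (rule arg_cong[where f = All], rule ext)
    fix n
    have "G (Suc n) = - (p (a + 1 + real n) * (y (a + real n) - y (a + real (Suc n))))"
      by (simp add: G_def nabla_def backward_jump_def algebra_simps)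
    moreover have "p (a + 1 + real n) \<noteq> 0"
      using p[of "Suc n"] by (simp add: add_ac)
    ultimately show "(G (Suc n) = - (\<Sum>k\<le>n. rising_coeff \<nu> (n - k) * \<phi> k)) \<longleftrightarrow>
        y (a + real n) - y (a + real (Suc n))
          = 1 / p (a + 1 + real n) * (\<Sum>k\<le>n. rising_coeff \<nu> (n - k) * \<phi> k)"
      by (auto simp: field_simps)
  qed
  finally show ?thesis
    by (simp add: \<phi>_def)
qed

text \<open>The condition at \<open>a\<close> fixes the value at \<open>a - 1\<close>, so a member
  of \<open>zeta a M\<close> carries the same information as a decreasing sequence above
  \<open>M\<close>.\<close>

lemma zeta_iff:
  "y \<in> zeta a M \<longleftrightarrow> y \<in> extensional (nabla_dom (a - 1)) \<and> y (a - 1) = y a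
    \<and> antimono (\<lambda>n. y (a + real n)) \<and> (\<forall>n. M \<le> y (a + real n))"
proof -
  have dom: "nabla_dom (a - 1) = insert (a - 1) (range (\<lambda>n. a + real n))"
  proof -
    have "(UNIV :: nat set) = insert 0 (range Suc)"
      by (rule UNIV_nat_eq)
    then have "nabla_dom (a - 1) = (\<lambda>n. a - 1 + real n) ` insert 0 (range Suc)"
      by (simp add: nabla_dom_def)
    then show ?thesis
      by (simp add: image_image)
  qed
  have "(\<forall>n. nabla y (a + real n) \<le> 0) \<and> nabla y a = 0
      \<longleftrightarrow> antimono (\<lambda>n. y (a + real n)) \<and> y (a - 1) = y a"
  proof -
    have step: "nabla y (a + real (Suc n)) = y (a + real (Suc n)) - y (a + real n)" for n
      by (simp add: nabla_def backward_jump_def algebra_simps)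
    have "(\<forall>n. nabla y (a + real n) \<le> 0) \<longleftrightarrow> nabla y a \<le> 0 \<and> (\<forall>n. nabla y (a + real (Suc n)) \<le> 0)"
      by (metis add_0_right not0_implies_Suc of_nat_0)
    then show ?thesis
      unfolding step by (auto simp: decseq_Suc_iff nabla_def backward_jump_def)
  qed
  moreover have "y \<in> nabla_dom (a - 1) \<rightarrow>\<^sub>E {M..} \<longleftrightarrow> y \<in> extensional (nabla_dom (a - 1))
      \<and> M \<le> y (a - 1) \<and> (\<forall>n. M \<le> y (a + real n))"
    by (auto simp: PiE_def dom)
  moreover have "y (a - 1) = y a \<Longrightarrow> (\<forall>n. M \<le> y (a + real n)) \<Longrightarrow> M \<le> y (a - 1)"
    by (metis add_0_right of_nat_0)
  ultimately show ?thesis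
    unfolding zeta_def nabla_dom_ball by blast
qed

text \<open>Continuity of exp gives L = exp(-S) with S the nonnegative sum of the series of
  1/p.\<close>

lemma weight_limit_bounds:
  assumes p: "p \<in> nabla_dom a \<rightarrow> {0<..}"
    and p_summable: "summable (\<lambda>n. 1 / p (a + real n))"
    and L: "(\<lambda>n. weight a p (a - 1 + real n)) \<longlonglongrightarrow> L"
  shows "0 < L" "L \<le> 1"
proof -
  \<comment> \<open>The shift skips the point \<open>a - 1\<close>, where the sum in the exponent is
    empty.\<close>
  have "weight a p (a - 1 + real (Suc n)) = exp (- (\<Sum>k\<le>n. 1 / p (a + real k)))" for n
    using nabla_sum_conv[of a n "\<lambda>s. 1 / p s"] by (simp add: weight_def)
  then have "(\<lambda>n. exp (- (\<Sum>k\<le>n. 1 / p (a + real k)))) \<longlonglongrightarrow> L"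
    using LIMSEQ_Suc[OF L] by simp
  moreover have "(\<lambda>n. exp (- (\<Sum>k\<le>n. 1 / p (a + real k)))) \<longlonglongrightarrow> exp (- (\<Sum>k. 1 / p (a + real k)))"
    by (intro tendsto_exp tendsto_minus summable_LIMSEQ' p_summable)
  ultimately have "L = exp (- (\<Sum>k. 1 / p (a + real k)))"
    by (rule LIMSEQ_unique)
  moreover have "0 \<le> (\<Sum>k. 1 / p (a + real k))"
    using p by (intro suminf_nonneg p_summable) (auto simp: nabla_dom_def Pi_iff less_imp_le)
  ultimately show "0 < L" "L \<le> 1"
    by auto
qed

section \<open>Existence, uniqueness and positivity for the fractional equation\<close>

text \<open>Positivity is claimed under a guard: if M = 0 and F(t,0) = 0 for all t, the zero
  function on the half-line is itself the unique solution. Uniqueness is asserted within all of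
  \<open>zeta a M\<close>.\<close>

theorem theorem2p2:
  fixes a \<nu> M K L :: real
    and F :: "real \<Rightarrow> real \<Rightarrow> real"
    and p :: "real \<Rightarrow> real"
  assumes nu: "0 < \<nu>" "\<nu> < 1"
    and M: "0 \<le> M"
    and F: "F \<in> nabla_dom (a + 1) \<rightarrow> {0..} \<rightarrow> {0..}"
    and K: "0 < K"
    and Lipschitz: "\<And>t u v. t \<in> nabla_dom (a + 1) \<Longrightarrow> 0 \<le> u \<Longrightarrow> 0 \<le> v \<Longrightarrow>
                      \<bar>F t u - F t v\<bar> \<le> K * \<bar>u - v\<bar>"
    and p: "p \<in> nabla_dom a \<rightarrow> {0<..}"
    and p_summable: "summable (\<lambda>n. 1 / p (a + real n))"
    and L: "(\<lambda>n. weight a p (a - 1 + real n)) \<longlonglongrightarrow> L"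
    and H1: "\<And>y. y \<in> zeta a M \<Longrightarrow>
               summable (\<lambda>n. let s = a + 1 + real n in
                 1 / p s * nabla_sum (a + 1) s
                   (\<lambda>\<tau>. rising (s - backward_jump \<tau>) (\<nu> - 1) / Gamma \<nu> * F \<tau> (y (backward_jump \<tau>))))"
    and H2_summable: "summable (\<lambda>n. let s = a + 1 + real n in rising (s - a) \<nu> / p s)"
    and H2: "K / (L * Gamma (\<nu> + 1)) *
               (\<Sum>n. let s = a + 1 + real n in rising (s - a) \<nu> / p s) < 1"
  shows "\<exists>y. y \<in> zeta a M \<and> is_solution a \<nu> p F y
             \<and> (\<lambda>n. y (a - 1 + real n)) \<longlonglongrightarrow> M
             \<and> (0 < M \<or> (\<exists>t\<in>nabla_dom (a + 1). F t 0 \<noteq> 0) \<longrightarrow> (\<forall>t\<in>nabla_dom (a - 1). 0 < y t))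
             \<and> (\<forall>z. z \<in> zeta a M \<and> is_solution a \<nu> p F z
                    \<and> (\<lambda>n. z (a - 1 + real n)) \<longlonglongrightarrow> M \<longrightarrow> z = y)"
proof -
  define Z_of where "Z_of = (\<lambda>(y :: real \<Rightarrow> real) n. y (a + real n))"
  \<comment> \<open>Inverse of \<open>Z_of\<close>. At t = a - 1 the floor is -1 and
    \<open>nat\<close> sends it to 0, so the value is \<open>Z 0\<close>, as the vanishing
    difference at \<open>a\<close> demands.\<close>
  define y_of where "y_of = (\<lambda>Z :: nat \<Rightarrow> real. \<lambda>t\<in>nabla_dom (a - 1). Z (nat \<lfloor>t - a\<rfloor>))"
  define c where "c = rising_coeff \<nu>"
  define Q where "Q = (\<lambda>n. 1 / p (a + 1 + real n))"
  define f where "f = (\<lambda>k. F (a + 1 + real k))"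
  define u where "u = (\<lambda>Z n. Q n * (\<Sum>k\<le>n. c (n - k) * f k (Z k)))"
  have p_pos: "0 < p (a + real n)" for n
    using p by (auto simp: nabla_dom_def Pi_iff)
  have Q_pos: "0 < Q n" for n
    using p_pos[of "Suc n"] by (simp add: Q_def add_ac)
  have c_pos: "0 < c n" for n
    using nu by (simp add: c_def rising_coeff_pos)
  have f_nonneg: "0 \<le> f k v" if "0 \<le> v" for k v
    using F that by (auto simp: f_def nabla_dom_def Pi_iff)
  have y_of: "y_of Z \<in> zeta a M" "Z_of (y_of Z) = Z" if "antimono Z" "\<And>n. M \<le> Z n" for Z
  proof -
    have "a + real n = a - 1 + real (Suc n)" for n
      by simp
    then have "a + real n \<in> nabla_dom (a - 1)" for n
      unfolding nabla_dom_def by (rule range_eqI)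
    then have y: "y_of Z (a + real n) = Z n" for n
      by (simp add: y_of_def)
    have "a - 1 = a - 1 + real 0"
      by simp
    then have "a - 1 \<in> nabla_dom (a - 1)"
      unfolding nabla_dom_def by (rule range_eqI)
    then have "y_of Z (a - 1) = Z 0"
      by (simp add: y_of_def)
    with y[of 0] y that show "y_of Z \<in> zeta a M"
      by (simp add: zeta_iff) (simp add: y_of_def)
    show "Z_of (y_of Z) = Z"
      by (simp add: Z_of_def y)
  qed
  have Z_of_inj: "y = z" if "y \<in> zeta a M" "z \<in> zeta a M" "Z_of y = Z_of z" for y z
  proof (rule extensionalityI[of _ "nabla_dom (a - 1)"])
    show "y \<in> extensional (nabla_dom (a - 1))" "z \<in> extensional (nabla_dom (a - 1))"
      using that by (simp_all add: zeta_iff)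
    have eq: "y (a + real n) = z (a + real n)" for n
      using fun_cong[OF that(3), of n] by (simp add: Z_of_def)
    have "y (a - 1 + real n) = z (a - 1 + real n)" for n
      using that(1,2) eq[of 0] eq[of "n - 1"] by (cases n) (auto simp: zeta_iff)
    then show "y t = z t" if "t \<in> nabla_dom (a - 1)" for t
      using that by (auto simp: nabla_dom_def)
  qed
  have sol_iff: "is_solution a \<nu> p F y \<longleftrightarrow> (\<forall>n. Z_of y n - Z_of y (Suc n) = u (Z_of y) n)"
    if "y \<in> zeta a M" for y
    unfolding Z_of_def u_def Q_def c_def f_def
    by (rule is_solution_iff[OF nu(2)]) (use that p_pos in \<open>auto simp: zeta_def less_imp_neq[symmetric]\<close>)
  have lim_iff: "(\<lambda>n. y (a - 1 + real n)) \<longlonglongrightarrow> M \<longleftrightarrow> Z_of y \<longlonglongrightarrow> M" for y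
    using filterlim_sequentially_Suc[of "\<lambda>n. y (a - 1 + real n)" "nhds M"] by (simp add: Z_of_def)
  have "\<exists>!Z. antimono Z \<and> (\<forall>n. M \<le> Z n) \<and> (\<forall>n. Z n - Z (Suc n) = u Z n) \<and> Z \<longlonglongrightarrow> M"
    unfolding u_def
  proof (rule ex1_decreasing_volterra_solution[where K = K and e = "rising_coeff (\<nu> + 1)"])
    show "\<bar>f k v - f k w\<bar> \<le> K * \<bar>v - w\<bar>" if "0 \<le> v" "0 \<le> w" for k v w
      using that by (auto simp: f_def nabla_dom_def intro!: Lipschitz)
    show "rising_coeff (\<nu> + 1) n = (\<Sum>k\<le>n. c (n - k))" for n
      by (simp add: c_def sum_rising_coeff)
    show "summable (\<lambda>n. Q n * (\<Sum>k\<le>n. c (n - k) * f k (Z k)))" if "antimono Z" "\<And>n. M \<le> Z n" for Z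
    proof -
      \<comment> \<open>The terms of the series in \<open>H1\<close> for the function
        \<open>y_of Z\<close> are the increments \<open>u Z n\<close>.\<close>
      have "1 / p (a + 1 + real n) * nabla_sum (a + 1) (a + 1 + real n)
          (\<lambda>\<tau>. rising (a + 1 + real n - backward_jump \<tau>) (\<nu> - 1) / Gamma \<nu> * F \<tau> (y_of Z (backward_jump \<tau>)))
          = Q n * (\<Sum>k\<le>n. c (n - k) * f k (Z k))" for n
        unfolding nabla_sum_conv Q_def
      proof (intro arg_cong2[where f = "(*)"] refl sum.cong)
        fix k assume "k \<in> {..n}"
        then have arg: "a + 1 + real n - backward_jump (a + 1 + real k) = real (n - k) + 1"
          by (simp add: backward_jump_def of_nat_diff)
        show "rising (a + 1 + real n - backward_jump (a + 1 + real k)) (\<nu> - 1) / Gamma \<nu> = c (n - k)"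
          by (simp only: arg rising_eq_coeff[OF nu(1)] c_def)
        have "backward_jump (a + 1 + real k) = a + real k"
          by (simp add: backward_jump_def)
        then show "F (a + 1 + real k) (y_of Z (backward_jump (a + 1 + real k))) = f k (Z k)"
          using fun_cong[OF y_of(2)[OF that], of k] by (simp add: f_def Z_of_def)
      qed
      then show ?thesis
        using H1[OF y_of(1)[OF that]] by (simp add: Let_def)
    qed
    have "Gamma (\<nu> + 1) \<noteq> 0"
      using nu by (intro less_imp_neq[symmetric] Gamma_real_pos) simp
    \<comment> \<open>Here s - a = n + 1. The factor \<open>Gamma (\<nu> + 1)\<close> cancels
      against the one in the denominator in \<open>H2\<close>.\<close>
    then have e: "rising (a + 1 + real n - a) \<nu> / p (a + 1 + real n) = Gamma (\<nu> + 1) * (Q n * rising_coeff (\<nu> + 1) n)" for n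
      using rising_eq_coeff[of "\<nu> + 1" n, symmetric] nu by (simp add: Q_def add_ac)
    show summ: "summable (\<lambda>n. Q n * rising_coeff (\<nu> + 1) n)"
      using H2_summable \<open>Gamma (\<nu> + 1) \<noteq> 0\<close> unfolding Let_def e by (simp add: summable_cmult_iff)
    have "K / L * (\<Sum>n. Q n * rising_coeff (\<nu> + 1) n) < 1"
      using H2 \<open>Gamma (\<nu> + 1) \<noteq> 0\<close> unfolding Let_def e suminf_mult[OF summ] by simp
    \<comment> \<open>This is where 0 < L \<le> 1 lets the weight be dropped.\<close>
    moreover have "K \<le> K / L"
      using weight_limit_bounds[OF p p_summable L] K by (simp add: field_simps)
    moreover have "0 \<le> (\<Sum>n. Q n * rising_coeff (\<nu> + 1) n)"
      using nu Q_pos by (intro suminf_nonneg[OF summ] mult_nonneg_nonneg)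
        (auto simp: less_imp_le rising_coeff_pos)
    ultimately show "K * (\<Sum>n. Q n * rising_coeff (\<nu> + 1) n) < 1"
      by (meson le_less_trans mult_right_mono)
  qed (use M K Q_pos c_pos f_nonneg in \<open>auto simp: less_imp_le\<close>)
  then obtain Z where Z: "antimono Z" "\<And>n. M \<le> Z n" "\<And>n. Z n - Z (Suc n) = u Z n" "Z \<longlonglongrightarrow> M"
    and uniq: "\<And>W. antimono W \<Longrightarrow> (\<And>n. M \<le> W n) \<Longrightarrow> (\<And>n. W n - W (Suc n) = u W n) \<Longrightarrow> W \<longlonglongrightarrow> M
      \<Longrightarrow> W = Z"
    by blast
  note y = y_of[OF Z(1,2)]
  have Z_pos: "0 < Z n" if pos: "0 < M \<or> (\<exists>t\<in>nabla_dom (a + 1). F t 0 \<noteq> 0)" for n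
  proof (rule ccontr)
    assume "\<not> 0 < Z n"
    then have "M = 0" "Z n = 0"
      using Z(2)[of n] M by auto
    have Z_nonneg: "0 \<le> Z m" for m
      using Z(2)[of m] M by simp
    have zero: "Z m = 0" if "n \<le> m" for m
      using antimonoD[OF Z(1) that] Z_nonneg[of m] \<open>Z n = 0\<close> by simp
    \<comment> \<open>A vanishing decrement forces all earlier values of \<open>f\<close> to vanish, as the kernel is positive.\<close>
    have f0: "f k (Z k) = 0" for k
    proof -
      \<comment> \<open>Large enough that the decrement at \<open>m\<close> lies in the zero range
        of \<open>Z\<close> and that \<open>k\<close> occurs in the sum.\<close>
      define m where "m = max n k"
      have "u Z m = 0"
        using Z(3)[of m] zero[of m] zero[of "Suc m"] by (simp add: m_def)
      then have "(\<Sum>k\<le>m. c (m - k) * f k (Z k)) = 0"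
        using Q_pos[of m] by (simp add: u_def)
      then have "\<forall>k\<in>{..m}. c (m - k) * f k (Z k) = 0"
        by (subst (asm) sum_nonneg_eq_0_iff) (auto simp: c_pos less_imp_le f_nonneg Z_nonneg)
      then have "c (m - k) * f k (Z k) = 0"
        by (auto simp: m_def)
      with c_pos[of "m - k"] show ?thesis
        by simp
    qed
    \<comment> \<open>Now every decrement vanishes, so \<open>Z\<close> is constant, equal to
      \<open>Z n = 0\<close>, and \<open>f0\<close> becomes a statement about F(t,0) that
      contradicts the guard.\<close>
    then have "Z m = Z (Suc m)" for m
      using Z(3)[of m] by (simp add: u_def)
    then have "Z m = Z 0" for m
      by (induction m) auto
    then have "Z m = 0" for m
      using \<open>Z n = 0\<close> by metis
    with f0 have "F (a + 1 + real k) 0 = 0" for k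
      by (simp add: f_def)
    with pos \<open>M = 0\<close> show False
      by (auto simp: nabla_dom_def)
  qed
  show ?thesis
  proof (intro exI conjI impI allI)
    show "y_of Z \<in> zeta a M"
      by (rule y(1))
    show "is_solution a \<nu> p F (y_of Z)"
      using Z(3) by (simp add: sol_iff y)
    show "(\<lambda>n. y_of Z (a - 1 + real n)) \<longlonglongrightarrow> M"
      using Z(4) by (simp add: lim_iff y)
    show "\<forall>t\<in>nabla_dom (a - 1). 0 < y_of Z t"
      if "0 < M \<or> (\<exists>t\<in>nabla_dom (a + 1). F t 0 \<noteq> 0)"
      using Z_pos[OF that] by (auto simp: y_of_def)
    show "z = y_of Z" if "z \<in> zeta a M \<and> is_solution a \<nu> p F z \<and> (\<lambda>n. z (a - 1 + real n)) \<longlonglongrightarrow> M" for z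
    proof (rule Z_of_inj)
      have "Z_of z = Z"
        using that sol_iff[of z] by (intro uniq) (auto simp: lim_iff, auto simp: zeta_iff Z_of_def)
      then show "Z_of z = Z_of (y_of Z)"
        by (simp add: y)
    qed (use that y in auto)
  qed
qed

end
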